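(* Let $M$ be a matroid on $E$ and $F_1,\dots,F_m\subseteq E$. Let $\mathfrak{S}_m$ be the symmetric group on $[m]$. The following are equivalent: (1) $\bigcap_{i=1}^m M(F_i)\neq\emptyset$; (2) the matroids $M(F_{\tau(1)})(F_{\tau(2)})\cdots(F_{\tau(m)})$ are the same for all $\tau\in\mathfrak{S}_m$; (3) $\bigcap_{i=1}^m M(F_i)$ equals the base collection of $M(F_{\tau(1)})\cdots(F_{\tau(m)})$ for some $\tau\in\mathfrak{S}_m$; (4) $\bigcap_{i=1}^m M(F_i)$ equals the base collection of $\bigodot_{i=1}^m M(F_i)$; (5) $\bigodot_{i=1}^m M(F_i)=M(F_{\tau(1)})\cdots(F_{\tau(m)})$ for some $\tau\in\mathfrak{S}_m$; (6) $r\big(\bigodot_{i=1}^m M(F_i)\big)=r(M)$.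
   Context: For a matroid $M$ on $E$ and $F\subseteq E$, $M(F):=(M/F)\oplus(M|_F)$, a matroid on $E$; iterated, $M(F_1)(F_2)\cdots(F_m):=(\cdots((M(F_1))(F_2))\cdots)(F_m)$. For matroids $N_1,\dots,N_m$ on $E$, $\bigcap_i N_i$ denotes the collection of sets that are bases of every $N_i$ (the base intersection). For $\sigma\subseteq[m]$ let $F^+_\sigma=\bigcup_{i\in\sigma}F_i$ and $F^-_\sigma=\bigcap_{j\notin\sigma}F_j$ (with $F^-_{[m]}=E$); the sets $F^-_\sigma\setminus F^+_\sigma$ partition $E$. Define the matroid on $E$ $$\bigodot_{i=1}^m M(F_i):=\bigoplus_{\sigma\subseteq[m]}\big(M/F^+_\sigma\big)\big|_{F^-_\sigma\setminus F^+_\sigma}.$$ *)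

theory Defs
  imports Main "HOL-Combinatorics.Permutations"
begin

text \<open>
  A matroid is represented by its ground set together with its independent sets, so equality on
  this type is equality of matroids. The axioms are imposed by the predicate \<open>is_matroid\<close>.
\<close>

datatype 'a matroid = Matroid (ground: "'a set") (indep: "'a set set")

definition is_matroid :: "'a matroid \<Rightarrow> bool" where
  "is_matroid M \<longleftrightarrow>
     finite (ground M) \<and>
     (\<forall>I\<in>indep M. I \<subseteq> ground M) \<and>
     {} \<in> indep M \<and>
     (\<forall>I\<in>indep M. \<forall>J. J \<subseteq> I \<longrightarrow> J \<in> indep M) \<and>
     (\<forall>I\<in>indep M. \<forall>J\<in>indep M. card I < card J \<longrightarrow> (\<exists>x\<in>J - I. insert x I \<in> indep M))"

definition bases :: "'a matroid \<Rightarrow> 'a set set" where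
  "bases M = {B \<in> indep M. \<forall>I\<in>indep M. B \<subseteq> I \<longrightarrow> I = B}"

definition rank_of :: "'a matroid \<Rightarrow> 'a set \<Rightarrow> nat" where
  "rank_of M X = Max (card ` {I \<in> indep M. I \<subseteq> X})"

definition rank :: "'a matroid \<Rightarrow> nat" where
  "rank M = rank_of M (ground M)"

definition restriction :: "'a matroid \<Rightarrow> 'a set \<Rightarrow> 'a matroid" where
  "restriction M F = Matroid (ground M \<inter> F) {I \<in> indep M. I \<subseteq> F}"

definition contraction :: "'a matroid \<Rightarrow> 'a set \<Rightarrow> 'a matroid" where
  "contraction M F =
     Matroid (ground M - F)
       {I. I \<subseteq> ground M - F \<and> (\<exists>J \<in> bases (restriction M F). I \<union> J \<in> indep M)}"

text \<open>The direct sums below are only meaningful for pairwise disjoint ground sets.\<close>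

definition direct_sum :: "'a matroid \<Rightarrow> 'a matroid \<Rightarrow> 'a matroid" where
  "direct_sum M N = Matroid (ground M \<union> ground N) {I \<union> J | I J. I \<in> indep M \<and> J \<in> indep N}"

definition Direct_Sum :: "'i set \<Rightarrow> ('i \<Rightarrow> 'a matroid) \<Rightarrow> 'a matroid" where
  "Direct_Sum S N =
     Matroid (\<Union>s\<in>S. ground (N s)) {\<Union>s\<in>S. I s | I. \<forall>s\<in>S. I s \<in> indep (N s)}"

text \<open>\<open>face_matroid M F\<close> is \<open>M(F) = (M/F) \<oplus> M|F\<close>, and \<open>iter_face_matroid M [F1, \<dots>, Fm]\<close> is
  \<open>M(F1)(F2)\<dots>(Fm)\<close>, with \<open>F1\<close> applied first.\<close>

definition face_matroid :: "'a matroid \<Rightarrow> 'a set \<Rightarrow> 'a matroid" where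
  "face_matroid M F = direct_sum (contraction M F) (restriction M F)"

definition iter_face_matroid :: "'a matroid \<Rightarrow> 'a set list \<Rightarrow> 'a matroid" where
  "iter_face_matroid M Fs = foldl face_matroid M Fs"

definition F_plus :: "(nat \<Rightarrow> 'a set) \<Rightarrow> nat set \<Rightarrow> 'a set" where
  "F_plus F \<sigma> = (\<Union>i\<in>\<sigma>. F i)"

text \<open>Intersecting with \<open>E\<close> realises the convention that the empty intersection is \<open>E\<close>;
  it has no other effect when all \<open>F i\<close> are subsets of \<open>E\<close>.\<close>

definition F_minus :: "'a set \<Rightarrow> nat \<Rightarrow> (nat \<Rightarrow> 'a set) \<Rightarrow> nat set \<Rightarrow> 'a set" where
  "F_minus E m F \<sigma> = E \<inter> (\<Inter>j\<in>{1..m} - \<sigma>. F j)"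

definition odot :: "'a matroid \<Rightarrow> nat \<Rightarrow> (nat \<Rightarrow> 'a set) \<Rightarrow> 'a matroid" where
  "odot M m F =
     Direct_Sum (Pow {1..m})
       (\<lambda>\<sigma>. restriction (contraction M (F_plus F \<sigma>)) (F_minus (ground M) m F \<sigma> - F_plus F \<sigma>))"


lemma is_matroidD:
  assumes "is_matroid M"
  shows "finite (ground M)" "I \<in> indep M \<Longrightarrow> I \<subseteq> ground M" "I \<in> indep M \<Longrightarrow> finite I"
    "{} \<in> indep M" "I \<in> indep M \<Longrightarrow> J \<subseteq> I \<Longrightarrow> J \<in> indep M"
    "I \<in> indep M \<Longrightarrow> J \<in> indep M \<Longrightarrow> card I < card J \<Longrightarrow> \<exists>x\<in>J - I. insert x I \<in> indep M"
proof -
  have *: "finite (ground M)" "\<And>I. I \<in> indep M \<Longrightarrow> I \<subseteq> ground M" "{} \<in> indep M"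
    "\<And>I J. I \<in> indep M \<Longrightarrow> J \<subseteq> I \<Longrightarrow> J \<in> indep M"
    "\<And>I J. I \<in> indep M \<Longrightarrow> J \<in> indep M \<Longrightarrow> card I < card J \<Longrightarrow> \<exists>x\<in>J - I. insert x I \<in> indep M"
    using assms by (simp_all add: is_matroid_def)
  show "finite (ground M)" "I \<in> indep M \<Longrightarrow> I \<subseteq> ground M" "{} \<in> indep M"
    "I \<in> indep M \<Longrightarrow> J \<subseteq> I \<Longrightarrow> J \<in> indep M"
    "I \<in> indep M \<Longrightarrow> J \<in> indep M \<Longrightarrow> card I < card J \<Longrightarrow> \<exists>x\<in>J - I. insert x I \<in> indep M"
    by (fact *)+
  show "I \<in> indep M \<Longrightarrow> finite I" using *(1,2) finite_subset by metis
qed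

lemma is_matroid_restriction:
  assumes "is_matroid M"
  shows "is_matroid (restriction M F)"
proof -
  have "\<exists>x\<in>J - I. insert x I \<in> indep (restriction M F)"
    if I: "I \<in> indep (restriction M F)" and J: "J \<in> indep (restriction M F)"
      and c: "card I < card J" for I J
  proof -
    have IJ: "I \<in> indep M" "J \<in> indep M" "I \<subseteq> F" "J \<subseteq> F"
      using I J by (simp_all add: restriction_def)
    obtain x where "x \<in> J - I" "insert x I \<in> indep M"
      using is_matroidD(6)[OF assms IJ(1,2) c] by blast
    then show ?thesis using IJ by (intro bexI[of _ x]) (auto simp: restriction_def)
  qed
  moreover have "J \<in> indep (restriction M F)" if "I \<in> indep (restriction M F)" "J \<subseteq> I" for I J
    using that is_matroidD(5)[OF assms, of I J] by (auto simp: restriction_def)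
  moreover have "\<forall>I\<in>indep (restriction M F). I \<subseteq> ground (restriction M F)"
    using is_matroidD(2)[OF assms] by (auto simp: restriction_def)
  moreover have "{} \<in> indep (restriction M F)" "finite (ground (restriction M F))"
    using is_matroidD(1,4)[OF assms] by (simp_all add: restriction_def)
  ultimately show ?thesis unfolding is_matroid_def by blast
qed

lemma augment_to:
  assumes M: "is_matroid M" and "I \<in> indep M" "J \<in> indep M" "card I \<le> card J"
  shows "\<exists>K\<in>indep M. I \<subseteq> K \<and> K \<subseteq> I \<union> J \<and> card K = card J"
  using assms(2,4)
proof (induction "card J - card I" arbitrary: I)
  case 0
  then show ?case by auto
next
  case (Suc n)
  then have "card I < card J" by simp
  with Suc.prems obtain x where x: "x \<in> J - I" "insert x I \<in> indep M"
    using is_matroidD(6)[OF M _ assms(3)] by blast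
  have c: "card (insert x I) = Suc (card I)"
    using x is_matroidD(3)[OF M Suc.prems(1)] by simp
  have "\<exists>K\<in>indep M. insert x I \<subseteq> K \<and> K \<subseteq> insert x I \<union> J \<and> card K = card J"
    using Suc.hyps x c \<open>card I < card J\<close> by (intro Suc.hyps(1)) auto
  then show ?case using x by blast
qed

lemma bases_card_ge:
  assumes M: "is_matroid M" and "B \<in> bases M" "I \<in> indep M"
  shows "card I \<le> card B"
proof (rule ccontr)
  assume "\<not> card I \<le> card B"
  then obtain x where "x \<in> I - B" "insert x B \<in> indep M"
    using is_matroidD(6)[OF M, of B I] assms(2,3) by (auto simp: bases_def)
  then show False using assms(2) by (auto simp: bases_def)
qed

lemma bases_nonempty:
  assumes M: "is_matroid M"
  shows "bases M \<noteq> {}"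
proof -
  have "finite (indep M)"
  proof (rule finite_subset)
    show "indep M \<subseteq> Pow (ground M)" using is_matroidD(2)[OF M] by blast
    show "finite (Pow (ground M))" using is_matroidD(1)[OF M] by simp
  qed
  then have fin: "finite (card ` indep M)" by simp
  have "card ` indep M \<noteq> {}" using is_matroidD(4)[OF M] by blast
  then obtain B where B: "B \<in> indep M" "card B = Max (card ` indep M)"
    using Max_in[OF fin] by (metis imageE)
  have "card I \<le> card B" if "I \<in> indep M" for I
    unfolding B(2) using that fin by (intro Max_ge) auto
  then have "I = B" if "I \<in> indep M" "B \<subseteq> I" for I
    using card_seteq[OF is_matroidD(3)[OF M that(1)] that(2)] that(1) by simp
  then have "B \<in> bases M" using B(1) by (simp add: bases_def)
  then show ?thesis by blast
qed

lemma contraction_indep_any_base: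
  assumes M: "is_matroid M" and I: "I \<subseteq> ground M - F" "I \<union> J \<in> indep M"
    and J: "J \<in> bases (restriction M F)" and J': "J' \<in> bases (restriction M F)"
  shows "I \<union> J' \<in> indep M"
proof -
  have R: "is_matroid (restriction M F)" by (rule is_matroid_restriction[OF M])
  have JF: "J \<in> indep M" "J \<subseteq> F" "J' \<in> indep M" "J' \<subseteq> F"
    using J J' by (auto simp: bases_def restriction_def)
  have cJ: "card J = card J'"
    using bases_card_ge[OF R J, of J'] bases_card_ge[OF R J', of J] JF
    by (simp add: restriction_def)
  have fin: "finite (I \<union> J)" "finite J'"
    using is_matroidD(3)[OF M] I(2) JF(3) by blast+
  have cIJ: "card (I \<union> J) = card I + card J" "card (I \<union> J') = card I + card J'"
    using fin I(1) JF by (auto intro!: card_Un_disjoint)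
  obtain K where K: "K \<in> indep M" "J' \<subseteq> K" "K \<subseteq> J' \<union> (I \<union> J)" "card K = card (I \<union> J)"
    using augment_to[OF M JF(3) I(2)] cIJ cJ by auto
  have "K \<inter> F \<in> indep (restriction M F)"
    using is_matroidD(5)[OF M K(1)] by (auto simp: restriction_def)
  then have "K \<inter> F = J'" using J' K(2) JF(4) by (auto simp: bases_def)
  then have "K \<subseteq> I \<union> J'" using K(3) JF(2) by blast
  then have "K = I \<union> J'" using K(4) cIJ cJ fin by (intro card_seteq) auto
  then show ?thesis using K(1) by simp
qed

lemma is_matroid_contraction:
  assumes M: "is_matroid M"
  shows "is_matroid (contraction M F)"
proof -
  obtain B where B: "B \<in> bases (restriction M F)"
    using bases_nonempty[OF is_matroid_restriction[OF M]] by blast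
  then have BF: "B \<in> indep M" "B \<subseteq> F" by (auto simp: bases_def restriction_def)
  have eq: "indep (contraction M F) = {I. I \<subseteq> ground M - F \<and> I \<union> B \<in> indep M}"
    using B contraction_indep_any_base[OF M] unfolding contraction_def by auto
  have "\<exists>x\<in>J - I. insert x I \<in> indep (contraction M F)"
    if I: "I \<in> indep (contraction M F)" and J: "J \<in> indep (contraction M F)"
      and c: "card I < card J" for I J
  proof -
    have d: "I \<union> B \<in> indep M" "J \<union> B \<in> indep M" "I \<inter> B = {}" "J \<inter> B = {}"
      using I J BF by (auto simp: eq)
    then have f: "finite I" "finite J" "finite B" using is_matroidD(3)[OF M] by blast+
    have "card (I \<union> B) < card (J \<union> B)" using c d f by (simp add: card_Un_disjoint)
    then obtain x where "x \<in> (J \<union> B) - (I \<union> B)" "insert x (I \<union> B) \<in> indep M"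
      using is_matroidD(6)[OF M d(1,2)] by blast
    then show ?thesis using I J by (intro bexI[of _ x]) (auto simp: eq)
  qed
  moreover have "J \<in> indep (contraction M F)"
    if "I \<in> indep (contraction M F)" "J \<subseteq> I" for I J
    using that is_matroidD(5)[OF M, of "I \<union> B" "J \<union> B"] by (auto simp: eq)
  moreover have "\<forall>I\<in>indep (contraction M F). I \<subseteq> ground (contraction M F)"
    by (simp add: contraction_def)
  moreover have "{} \<in> indep (contraction M F)" using BF by (simp add: eq)
  moreover have "finite (ground (contraction M F))"
    using is_matroidD(1)[OF M] by (simp add: contraction_def)
  ultimately show ?thesis unfolding is_matroid_def by blast
qed

lemma indep_Direct_Sum:
  assumes N: "\<And>s. s \<in> S \<Longrightarrow> is_matroid (N s)"
    and disj: "\<And>s t. s \<in> S \<Longrightarrow> t \<in> S \<Longrightarrow> s \<noteq> t \<Longrightarrow> ground (N s) \<inter> ground (N t) = {}"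
  shows "X \<in> indep (Direct_Sum S N) \<longleftrightarrow>
    X \<subseteq> (\<Union>s\<in>S. ground (N s)) \<and> (\<forall>s\<in>S. X \<inter> ground (N s) \<in> indep (N s))"
proof
  assume "X \<in> indep (Direct_Sum S N)"
  then obtain I where I: "X = (\<Union>s\<in>S. I s)" "\<forall>s\<in>S. I s \<in> indep (N s)"
    by (auto simp: Direct_Sum_def)
  have sub: "\<And>s. s \<in> S \<Longrightarrow> I s \<subseteq> ground (N s)" using I(2) is_matroidD(2)[OF N] by blast
  have "X \<inter> ground (N s) = I s" if "s \<in> S" for s
    using sub disj that unfolding I(1) by blast
  then show "X \<subseteq> (\<Union>s\<in>S. ground (N s)) \<and> (\<forall>s\<in>S. X \<inter> ground (N s) \<in> indep (N s))"
    using I sub by auto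
next
  assume "X \<subseteq> (\<Union>s\<in>S. ground (N s)) \<and> (\<forall>s\<in>S. X \<inter> ground (N s) \<in> indep (N s))"
  then show "X \<in> indep (Direct_Sum S N)"
    unfolding Direct_Sum_def by (auto intro!: exI[of _ "\<lambda>s. X \<inter> ground (N s)"])
qed

lemma is_matroid_Direct_Sum:
  assumes S: "finite S" and N: "\<And>s. s \<in> S \<Longrightarrow> is_matroid (N s)"
    and disj: "\<And>s t. s \<in> S \<Longrightarrow> t \<in> S \<Longrightarrow> s \<noteq> t \<Longrightarrow> ground (N s) \<inter> ground (N t) = {}"
  shows "is_matroid (Direct_Sum S N)"
proof -
  have ind: "X \<in> indep (Direct_Sum S N) \<longleftrightarrow>
      X \<subseteq> (\<Union>s\<in>S. ground (N s)) \<and> (\<forall>s\<in>S. X \<inter> ground (N s) \<in> indep (N s))" for X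
    by (rule indep_Direct_Sum) (fact N, fact disj)
  then have sub: "X \<subseteq> (\<Union>s\<in>S. ground (N s))" if "X \<in> indep (Direct_Sum S N)" for X
    using that by blast
  have fing: "finite (ground (N s))" if "s \<in> S" for s using is_matroidD(1)[OF N[OF that]] .
  have card: "card X = (\<Sum>s\<in>S. card (X \<inter> ground (N s)))"
    if "X \<subseteq> (\<Union>s\<in>S. ground (N s))" for X
  proof -
    have "X = (\<Union>s\<in>S. X \<inter> ground (N s))" using that by blast
    then have "card X = card (\<Union>s\<in>S. X \<inter> ground (N s))" by (rule arg_cong)
    also have "\<dots> = (\<Sum>s\<in>S. card (X \<inter> ground (N s)))"
      using S
    proof (rule card_UN_disjoint)
      show "\<forall>s\<in>S. finite (X \<inter> ground (N s))" using fing by blast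
      show "\<forall>s\<in>S. \<forall>t\<in>S. s \<noteq> t \<longrightarrow> X \<inter> ground (N s) \<inter> (X \<inter> ground (N t)) = {}"
        using disj by blast
    qed
    finally show ?thesis .
  qed
  have "\<exists>x\<in>J - I. insert x I \<in> indep (Direct_Sum S N)"
    if I: "I \<in> indep (Direct_Sum S N)" and J: "J \<in> indep (Direct_Sum S N)"
      and c: "card I < card J" for I J
  proof -
    obtain s where s: "s \<in> S" "card (I \<inter> ground (N s)) < card (J \<inter> ground (N s))"
    proof (rule ccontr)
      assume "\<not> thesis"
      then have "\<forall>s\<in>S. card (J \<inter> ground (N s)) \<le> card (I \<inter> ground (N s))"
        using that by (meson linorder_not_le)
      then have "card J \<le> card I"
        unfolding card[OF sub[OF I]] card[OF sub[OF J]] by (intro sum_mono) blast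
      then show False using c by simp
    qed
    then obtain x where x: "x \<in> J \<inter> ground (N s) - I \<inter> ground (N s)"
        "insert x (I \<inter> ground (N s)) \<in> indep (N s)"
      using is_matroidD(6)[OF N[OF s(1)]] I J s(1) ind by blast
    have "insert x I \<inter> ground (N t) \<in> indep (N t)" if t: "t \<in> S" for t
    proof (cases "t = s")
      case True
      then show ?thesis using x by (auto simp: Int_insert_left)
    next
      case False
      then have "insert x I \<inter> ground (N t) = I \<inter> ground (N t)"
        using disj[OF s(1) t] x(1) by auto
      then show ?thesis using I ind t by simp
    qed
    then have "insert x I \<in> indep (Direct_Sum S N)" using I x(1) s(1) by (auto simp: ind)
    then show ?thesis using x(1) by blast
  qed
  moreover have "J \<in> indep (Direct_Sum S N)"
    if "I \<in> indep (Direct_Sum S N)" "J \<subseteq> I" for I J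
  proof -
    have "J \<inter> ground (N s) \<in> indep (N s)" if "s \<in> S" for s
      using is_matroidD(5)[OF N[OF that], of "I \<inter> ground (N s)" "J \<inter> ground (N s)"]
        \<open>I \<in> _\<close> \<open>J \<subseteq> I\<close> that by (auto simp: ind)
    then show ?thesis using that by (auto simp: ind)
  qed
  moreover have "{} \<in> indep (Direct_Sum S N)" using is_matroidD(4)[OF N] by (simp add: ind)
  moreover have "finite (ground (Direct_Sum S N))" using S fing by (simp add: Direct_Sum_def)
  moreover have "\<forall>I\<in>indep (Direct_Sum S N). I \<subseteq> ground (Direct_Sum S N)"
  proof -
    have "ground (Direct_Sum S N) = (\<Union>s\<in>S. ground (N s))" by (simp add: Direct_Sum_def)
    then show ?thesis using sub by blast
  qed
  ultimately show ?thesis unfolding is_matroid_def by blast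
qed

lemma direct_sum_eq_Direct_Sum:
  "direct_sum M N = Direct_Sum UNIV (\<lambda>b. if b then M else N)"
proof -
  have "{I \<union> J | I J. I \<in> indep M \<and> J \<in> indep N} =
      {\<Union>b. I b | I. \<forall>b. I b \<in> indep (if b then M else N)}" (is "?L = ?R")
  proof (intro set_eqI iffI)
    fix X assume "X \<in> ?L"
    then obtain I J where "X = I \<union> J" "I \<in> indep M" "J \<in> indep N" by blast
    then show "X \<in> ?R"
      by (auto simp: UNIV_bool intro!: exI[of _ "\<lambda>b. if b then I else J"])
  next
    fix X assume "X \<in> ?R"
    then obtain I where I: "X = (\<Union>b. I b)" "\<And>b. I b \<in> indep (if b then M else N)" by blast
    then have "X = I True \<union> I False" by (auto simp: UNIV_bool)
    then show "X \<in> ?L" using I(2)[of True] I(2)[of False] by auto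
  qed
  moreover have "ground M \<union> ground N = (\<Union>b. ground (if b then M else N))"
    by (auto simp: UNIV_bool)
  ultimately show ?thesis by (simp only: direct_sum_def Direct_Sum_def UNIV_I Ball_def simp_thms)
qed

lemma is_matroid_face_matroid:
  assumes "is_matroid M"
  shows "is_matroid (face_matroid M F)"
  unfolding face_matroid_def direct_sum_eq_Direct_Sum
proof (rule is_matroid_Direct_Sum)
  show "is_matroid (if b then contraction M F else restriction M F)" for b
    by (simp add: is_matroid_restriction[OF assms] is_matroid_contraction[OF assms])
  show "ground (if b then contraction M F else restriction M F) \<inter>
      ground (if c then contraction M F else restriction M F) = {}" if "b \<noteq> c" for b c
    using that by (cases b; cases c) (auto simp: restriction_def contraction_def)
qed simp

lemma ground_face_matroid: "ground (face_matroid M F) = ground M"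
  by (auto simp: face_matroid_def direct_sum_def contraction_def restriction_def)

lemma is_matroid_odot:
  assumes "is_matroid M"
  shows "is_matroid (odot M m F)"
  unfolding odot_def
proof (rule is_matroid_Direct_Sum)
  fix \<sigma> \<tau> assume st: "\<sigma> \<in> Pow {1..m}" "\<tau> \<in> Pow {1..m}" "\<sigma> \<noteq> \<tau>"
  have "(F_minus (ground M) m F \<sigma> - F_plus F \<sigma>) \<inter> (F_minus (ground M) m F \<tau> - F_plus F \<tau>) = {}"
  proof (rule ccontr)
    assume "\<not> ?thesis"
    then obtain x where x: "x \<in> F_minus (ground M) m F \<sigma>" "x \<notin> F_plus F \<sigma>"
        "x \<in> F_minus (ground M) m F \<tau>" "x \<notin> F_plus F \<tau>" by blast
    have "i \<in> \<sigma> \<longleftrightarrow> x \<notin> F i" "i \<in> \<tau> \<longleftrightarrow> x \<notin> F i" if "i \<in> {1..m}" for i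
      using that x unfolding F_minus_def F_plus_def by blast+
    then show False using st by blast
  qed
  then show "ground (restriction (contraction M (F_plus F \<sigma>)) (F_minus (ground M) m F \<sigma> - F_plus F \<sigma>)) \<inter>
      ground (restriction (contraction M (F_plus F \<tau>)) (F_minus (ground M) m F \<tau> - F_plus F \<tau>)) = {}"
    unfolding restriction_def matroid.sel by blast
qed (simp_all add: is_matroid_restriction is_matroid_contraction assms)

lemma ground_odot:
  assumes "\<And>i. i \<in> {1..m} \<Longrightarrow> F i \<subseteq> ground M"
  shows "ground (odot M m F) = ground M"
proof
  show "ground (odot M m F) \<subseteq> ground M"
    by (auto simp: odot_def Direct_Sum_def restriction_def contraction_def)
  show "ground M \<subseteq> ground (odot M m F)"
  proof
    fix x assume "x \<in> ground M"
    then show "x \<in> ground (odot M m F)"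
      unfolding odot_def Direct_Sum_def restriction_def contraction_def F_plus_def F_minus_def
      by (auto intro!: bexI[of _ "{i \<in> {1..m}. x \<notin> F i}"])
  qed
qed

end

theory Submission
  imports Defs
begin

text \<open>
  A base of \<open>M(F)\<close> is a base \<open>B\<close> of \<open>M\<close> for which \<open>B \<inter> F\<close> spans \<open>F\<close>. Hence the base intersection
  consists of the bases that span every \<open>F\<^sub>i\<close> in this sense, and \<open>M(F\<^sub>1)\<dots>(F\<^sub>m)\<close> selects the bases that
  lexicographically maximise \<open>(|B \<inter> F\<^sub>1|, \<dots>, |B \<inter> F\<^sub>m|)\<close>. If all these numbers can be maximal
  simultaneously, the two collections agree.

  As to \<open>\<odot>\<close>: a set spanning every \<open>F\<^sub>i\<close> also spans their unions, so the base intersection consists of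
  independent sets of \<open>\<odot>\<close>. Conversely, every independent set of \<open>\<odot>\<close> is independent in every \<open>M(F\<^sub>i)\<close>:
  add its pieces one by one, those with \<open>i \<notin> \<sigma>\<close> first, and by increasing \<open>|\<sigma>|\<close> within each of the
  two groups; then all pieces before \<open>\<sigma>\<close> lie in \<open>F\<^sup>+\<^sub>\<sigma>\<close>, modulo which the piece of \<open>\<sigma>\<close> is
  independent.
\<close>

section \<open>Bases, restriction and contraction\<close>

lemma bases_iff_card:
  assumes M: "is_matroid M"
  shows "B \<in> bases M \<longleftrightarrow> B \<in> indep M \<and> (\<forall>I\<in>indep M. card I \<le> card B)"
proof
  assume "B \<in> bases M"
  then show "B \<in> indep M \<and> (\<forall>I\<in>indep M. card I \<le> card B)"
    using bases_card_ge[OF M] by (auto simp: bases_def)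
next
  assume B: "B \<in> indep M \<and> (\<forall>I\<in>indep M. card I \<le> card B)"
  then have "I = B" if "I \<in> indep M" "B \<subseteq> I" for I
    using card_seteq[OF is_matroidD(3)[OF M that(1)] that(2)] that(1) by simp
  then show "B \<in> bases M" using B by (simp add: bases_def)
qed

lemma bases_indep: "B \<in> bases M \<Longrightarrow> B \<in> indep M"
  by (simp add: bases_def)

lemma indep_extends_to_base:
  assumes M: "is_matroid M" and I: "I \<in> indep M"
  obtains B where "B \<in> bases M" "I \<subseteq> B"
proof -
  obtain C where C: "C \<in> bases M" using bases_nonempty[OF M] by blast
  then obtain K where "K \<in> indep M" "I \<subseteq> K" "card K = card C"
    using augment_to[OF M I bases_indep[OF C] bases_card_ge[OF M C I]] by blast
  then have "K \<in> bases M" using C by (simp add: bases_iff_card[OF M])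
  then show ?thesis using \<open>I \<subseteq> K\<close> by (rule that)
qed

lemma indep_restriction: "I \<in> indep (restriction M F) \<longleftrightarrow> I \<in> indep M \<and> I \<subseteq> F"
  by (simp add: restriction_def)

lemma indep_contraction:
  assumes "is_matroid M" "J \<in> bases (restriction M F)"
  shows "I \<in> indep (contraction M F) \<longleftrightarrow> I \<subseteq> ground M - F \<and> I \<union> J \<in> indep M"
  using contraction_indep_any_base[OF assms(1)] assms(2) by (auto simp: contraction_def)

text \<open>Extend \<open>K\<close> to a base of the restriction; any such base tests independence
  in the contraction. \<open>indep_odot_Un_cells\<close> adjoins each new piece this way.\<close>

lemma indep_contraction_Un:
  assumes M: "is_matroid M" and I: "I \<in> indep (contraction M F)"
    and K: "K \<in> indep M" "K \<subseteq> F"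
  shows "I \<union> K \<in> indep M"
proof -
  have "K \<in> indep (restriction M F)" using K by (simp add: indep_restriction)
  then obtain J where J: "J \<in> bases (restriction M F)" "K \<subseteq> J"
    using indep_extends_to_base[OF is_matroid_restriction[OF M]] by blast
  then have "I \<union> J \<in> indep M" using I indep_contraction[OF M] by blast
  then show ?thesis using is_matroidD(5)[OF M] J(2) by blast
qed

section \<open>Independent sets and bases of \<open>face_matroid M F\<close>\<close>

lemma indep_face_matroid:
  assumes M: "is_matroid M" and J: "J \<in> bases (restriction M F)"
  shows "I \<in> indep (face_matroid M F) \<longleftrightarrow>
    I \<subseteq> ground M \<and> I \<inter> F \<in> indep M \<and> (I - F) \<union> J \<in> indep M"
proof
  assume "I \<in> indep (face_matroid M F)"
  then obtain A B where AB: "I = A \<union> B" "A \<in> indep (contraction M F)" "B \<in> indep (restriction M F)"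
    by (auto simp: face_matroid_def direct_sum_def)
  then have *: "A \<subseteq> ground M - F" "A \<union> J \<in> indep M" "B \<in> indep M" "B \<subseteq> F"
    using indep_contraction[OF M J] by (auto simp: indep_restriction)
  then have "I \<inter> F = B" "I - F = A" using AB(1) by auto
  then show "I \<subseteq> ground M \<and> I \<inter> F \<in> indep M \<and> (I - F) \<union> J \<in> indep M"
    using * AB(1) is_matroidD(2)[OF M] by auto
next
  assume I: "I \<subseteq> ground M \<and> I \<inter> F \<in> indep M \<and> (I - F) \<union> J \<in> indep M"
  then have "I - F \<in> indep (contraction M F)" "I \<inter> F \<in> indep (restriction M F)"
    using indep_contraction[OF M J] by (auto simp: indep_restriction)
  moreover have "I = (I - F) \<union> (I \<inter> F)" by blast
  ultimately show "I \<in> indep (face_matroid M F)"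
    unfolding face_matroid_def direct_sum_def matroid.sel by blast
qed

text \<open>For a base \<open>B\<close> of M(F), enlarge \<open>B \<inter> F\<close> to a base
  \<open>J\<close> of the restriction. Exchanging it for \<open>J\<close> keeps independence in
  M(F), so maximality of \<open>B\<close> forces \<open>B \<inter> F = J\<close>. The converse
  counts elements inside and outside \<open>F\<close> separately.\<close>

lemma bases_face_matroid:
  assumes M: "is_matroid M"
  shows "bases (face_matroid M F) = {B \<in> bases M. B \<inter> F \<in> bases (restriction M F)}"
proof (intro set_eqI iffI)
  note R = is_matroid_restriction[OF M, of F]
  fix B assume B: "B \<in> bases (face_matroid M F)"
  then have Bi: "B \<in> indep (face_matroid M F)" by (rule bases_indep)
  obtain J0 where "J0 \<in> bases (restriction M F)" using bases_nonempty[OF R] by blast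
  then have "B \<inter> F \<in> indep (restriction M F)"
    using Bi indep_face_matroid[OF M] by (auto simp: indep_restriction)
  then obtain J where J: "J \<in> bases (restriction M F)" "B \<inter> F \<subseteq> J"
    using indep_extends_to_base[OF R] by blast
  have JF: "J \<in> indep M" "J \<subseteq> F" using bases_indep[OF J(1)] by (auto simp: indep_restriction)
  note ind = indep_face_matroid[OF M J(1)]
  have "(B - F) \<union> J \<in> indep M" using Bi ind by blast
  moreover have "((B - F) \<union> J) \<inter> F = J" "((B - F) \<union> J) - F = B - F" using JF(2) by auto
  ultimately have "(B - F) \<union> J \<in> indep (face_matroid M F)"
    using JF(1) is_matroidD(2)[OF M] unfolding ind by auto
  moreover have "B \<subseteq> (B - F) \<union> J" using J(2) by blast
  ultimately have eq: "(B - F) \<union> J = B" using B by (auto simp: bases_def)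
  then have BJ: "B \<inter> F = J" using JF(2) J(2) by blast
  have BM: "B \<in> indep M" using \<open>(B - F) \<union> J \<in> indep M\<close> eq by simp
  \<comment> \<open>Maximality of \<open>J\<close> forces an independent
    \<open>I \<supseteq> B\<close> to meet \<open>F\<close> exactly in \<open>J\<close>; hence
    \<open>I\<close> is independent in M(F), where \<open>B\<close> is already maximal.\<close>
  have "I = B" if I: "I \<in> indep M" "B \<subseteq> I" for I
  proof -
    have "I \<inter> F \<in> indep (restriction M F)"
      using is_matroidD(5)[OF M I(1)] by (simp add: indep_restriction)
    moreover have "J \<subseteq> I \<inter> F" using BJ I(2) by blast
    ultimately have IF: "I \<inter> F = J" using J(1) by (simp add: bases_def)
    then have "(I - F) \<union> J = I" by blast
    then have "I \<in> indep (face_matroid M F)"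
      using I(1) IF JF(1) is_matroidD(2)[OF M I(1)] unfolding ind by simp
    then show ?thesis using B I(2) by (auto simp: bases_def)
  qed
  then show "B \<in> {B \<in> bases M. B \<inter> F \<in> bases (restriction M F)}"
    using BM BJ J(1) by (simp add: bases_def)
next
  fix B assume "B \<in> {B \<in> bases M. B \<inter> F \<in> bases (restriction M F)}"
  then have B: "B \<in> bases M" and J: "B \<inter> F \<in> bases (restriction M F)" by auto
  note ind = indep_face_matroid[OF M J]
  have eq: "(B - F) \<union> (B \<inter> F) = B" by blast
  have Bi: "B \<in> indep (face_matroid M F)"
    unfolding ind eq using bases_indep[OF B] bases_indep[OF J] is_matroidD(2)[OF M]
    by (auto simp: indep_restriction)
  \<comment> \<open>Replacing \<open>I \<inter> F\<close> by the base \<open>B \<inter> F\<close> of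
    the restriction loses no elements and gives an independent set of \<open>M\<close>.\<close>
  have "card I \<le> card B" if I: "I \<in> indep (face_matroid M F)" for I
  proof -
    have *: "I \<inter> F \<in> indep M" "(I - F) \<union> (B \<inter> F) \<in> indep M" using I ind by auto
    have f: "finite I" "finite (B \<inter> F)"
      using is_matroidD(3)[OF is_matroid_face_matroid[OF M] I] is_matroidD(3)[OF M *(2)] by auto
    have "card I = card (I - F) + card (I \<inter> F)"
      using f by (subst card_Un_disjoint[symmetric]) (auto intro: arg_cong[where f=card])
    also have "\<dots> \<le> card (I - F) + card (B \<inter> F)"
      using bases_card_ge[OF is_matroid_restriction[OF M] J, of "I \<inter> F"] *(1)
      by (simp add: indep_restriction)
    also have "\<dots> = card ((I - F) \<union> (B \<inter> F))"
      using f by (intro card_Un_disjoint[symmetric]) auto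
    also have "\<dots> \<le> card B" using bases_card_ge[OF M B *(2)] .
    finally show ?thesis .
  qed
  then show "B \<in> bases (face_matroid M F)"
    using Bi by (simp add: bases_iff_card[OF is_matroid_face_matroid[OF M]])
qed

section \<open>Equality and rank in terms of bases\<close>

lemma indep_mono_bases:
  assumes "is_matroid M" "is_matroid N" "bases N \<subseteq> bases M"
  shows "indep N \<subseteq> indep M"
  using indep_extends_to_base[OF assms(2)] is_matroidD(5)[OF assms(1)] bases_indep assms(3)
  by (metis subsetD subsetI)

lemma matroid_eqI:
  assumes "is_matroid M" "is_matroid N" "ground M = ground N" "bases M = bases N"
  shows "M = N"
  using assms indep_mono_bases[of M N] indep_mono_bases[of N M]
  by (intro matroid.expand) auto

lemma rank_eq_card_base:
  assumes M: "is_matroid M" and B: "B \<in> bases M"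
  shows "rank M = card B"
  unfolding rank_def rank_of_def
proof (rule Max_eqI)
  have "{I \<in> indep M. I \<subseteq> ground M} \<subseteq> Pow (ground M)" by blast
  then show "finite (card ` {I \<in> indep M. I \<subseteq> ground M})"
    using is_matroidD(1)[OF M] finite_subset by blast
  show "card B \<in> card ` {I \<in> indep M. I \<subseteq> ground M}"
    using bases_indep[OF B] is_matroidD(2)[OF M] by blast
qed (use bases_card_ge[OF M B] in auto)

section \<open>Iterated face matroids\<close>

lemma iter_face_matroid_snoc:
  "iter_face_matroid M (Fs @ [F]) = face_matroid (iter_face_matroid M Fs) F"
  by (simp add: iter_face_matroid_def)

lemma is_matroid_iter_face_matroid:
  "is_matroid M \<Longrightarrow> is_matroid (iter_face_matroid M Fs)"
  by (induction Fs arbitrary: M) (simp_all add: iter_face_matroid_def is_matroid_face_matroid)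

lemma ground_iter_face_matroid: "ground (iter_face_matroid M Fs) = ground M"
  by (induction Fs arbitrary: M) (simp_all add: iter_face_matroid_def ground_face_matroid)

lemma bases_iter_face_matroid_subset:
  assumes "is_matroid M"
  shows "bases (iter_face_matroid M Fs) \<subseteq> bases M"
proof (induction Fs rule: rev_induct)
  case Nil
  show ?case by (simp add: iter_face_matroid_def)
next
  case (snoc F Fs)
  then show ?case
    using bases_face_matroid[OF is_matroid_iter_face_matroid[OF assms]]
    by (auto simp: iter_face_matroid_snoc)
qed

text \<open>The witness \<open>C\<close> survives every stage, so each iterate \<open>N\<close>
  still contains an independent set \<open>C \<inter> F\<close> of full size in \<open>F\<close>.
  Thus restricting \<open>N\<close> or \<open>M\<close> to \<open>F\<close> gives the same rank, and
  the condition imposed by the next \<open>F\<close> can be read off in \<open>M\<close>.\<close>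

lemma bases_iter_face_matroid:
  assumes M: "is_matroid M" and C: "C \<in> bases M"
    and "\<And>F. F \<in> set Fs \<Longrightarrow> C \<inter> F \<in> bases (restriction M F)"
  shows "bases (iter_face_matroid M Fs) =
    {B \<in> bases M. \<forall>F\<in>set Fs. B \<inter> F \<in> bases (restriction M F)}"
  using assms(3)
proof (induction Fs rule: rev_induct)
  case Nil
  show ?case by (simp add: iter_face_matroid_def)
next
  case (snoc F Fs)
  define N where "N = iter_face_matroid M Fs"
  have N: "is_matroid N" unfolding N_def by (rule is_matroid_iter_face_matroid[OF M])
  have bN: "bases N = {B \<in> bases M. \<forall>F\<in>set Fs. B \<inter> F \<in> bases (restriction M F)}"
    unfolding N_def using snoc by simp
  have sub: "indep N \<subseteq> indep M" using bN by (intro indep_mono_bases M N) auto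
  have CN: "C \<in> bases N" using C snoc.prems bN by simp
  have CF: "C \<inter> F \<in> bases (restriction M F)" using snoc.prems by simp
  have CFN: "C \<inter> F \<in> indep N" using is_matroidD(5)[OF N bases_indep[OF CN]] by simp
  \<comment> \<open>\<open>C \<inter> F\<close> supplies the lower bound on the rank of
    \<open>F\<close> in \<open>N\<close>, and \<open>sub\<close> the upper bound.\<close>
  have "B \<inter> F \<in> bases (restriction N F) \<longleftrightarrow> B \<inter> F \<in> bases (restriction M F)"
    if B: "B \<in> bases N" for B
  proof -
    have i: "B \<inter> F \<in> indep N" using is_matroidD(5)[OF N bases_indep[OF B]] by simp
    note b = bases_iff_card[OF is_matroid_restriction[OF N]]
      bases_iff_card[OF is_matroid_restriction[OF M]]
    show ?thesis
    proof
      assume "B \<inter> F \<in> bases (restriction N F)"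
      then have "card (C \<inter> F) \<le> card (B \<inter> F)" using CFN by (auto simp: b indep_restriction)
      then show "B \<inter> F \<in> bases (restriction M F)"
        using CF i sub by (auto simp: b indep_restriction intro: order_trans)
    next
      assume "B \<inter> F \<in> bases (restriction M F)"
      then show "B \<inter> F \<in> bases (restriction N F)"
        using i sub by (auto simp: b indep_restriction)
    qed
  qed
  then have "bases (face_matroid N F) = {B \<in> bases N. B \<inter> F \<in> bases (restriction M F)}"
    unfolding bases_face_matroid[OF N] by blast
  then show ?case unfolding iter_face_matroid_snoc N_def[symmetric] bN by auto
qed

section \<open>The matroid \<open>odot\<close> and its relation to the base intersection\<close>

lemma base_restriction_UN:
  assumes M: "is_matroid M" and B: "B \<in> indep M"
    and F: "\<And>i. i \<in> S \<Longrightarrow> B \<inter> F i \<in> bases (restriction M (F i))"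
  shows "B \<inter> (\<Union>i\<in>S. F i) \<in> bases (restriction M (\<Union>i\<in>S. F i))"
proof -
  let ?U = "\<Union>i\<in>S. F i"
  \<comment> \<open>An element of \<open>I\<close> outside \<open>B\<close> would lie in some
    \<open>F i\<close> and properly extend the base \<open>B \<inter> F i\<close> of the restriction
    to \<open>F i\<close>.\<close>
  have "I = B \<inter> ?U" if I: "I \<in> indep (restriction M ?U)" "B \<inter> ?U \<subseteq> I" for I
  proof
    show "I \<subseteq> B \<inter> ?U"
    proof
      fix x assume x: "x \<in> I"
      then obtain i where i: "i \<in> S" "x \<in> F i" using I(1) by (auto simp: indep_restriction)
      have "I \<inter> F i \<in> indep (restriction M (F i))"
        using I(1) is_matroidD(5)[OF M] by (auto simp: indep_restriction)
      moreover have "B \<inter> F i \<subseteq> I \<inter> F i" using I(2) i(1) by blast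
      ultimately have "I \<inter> F i = B \<inter> F i" using F[OF i(1)] by (auto simp: bases_def)
      then show "x \<in> B \<inter> ?U" using x i by blast
    qed
  qed (rule I(2))
  moreover have "B \<inter> ?U \<in> indep (restriction M ?U)"
    using is_matroidD(5)[OF M B] by (simp add: indep_restriction)
  ultimately show ?thesis by (simp add: bases_def)
qed

abbreviation odot_cell :: "'a matroid \<Rightarrow> nat \<Rightarrow> (nat \<Rightarrow> 'a set) \<Rightarrow> nat set \<Rightarrow> 'a set" where
  "odot_cell M m F \<sigma> \<equiv> F_minus (ground M) m F \<sigma> - F_plus F \<sigma>"

text \<open>An element thus determines the index of its cell, which yields both disjointness and
  covering.\<close>

lemma odot_cell_iff:
  assumes "\<sigma> \<subseteq> {1..m}"
  shows "x \<in> odot_cell M m F \<sigma> \<longleftrightarrow> x \<in> ground M \<and> \<sigma> = {i \<in> {1..m}. x \<notin> F i}"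
proof -
  have "x \<in> odot_cell M m F \<sigma> \<longleftrightarrow> x \<in> ground M \<and> (\<forall>i\<in>{1..m}. i \<in> \<sigma> \<longleftrightarrow> x \<notin> F i)"
    using assms by (auto simp: F_minus_def F_plus_def)
  also have "(\<forall>i\<in>{1..m}. i \<in> \<sigma> \<longleftrightarrow> x \<notin> F i) \<longleftrightarrow> \<sigma> = {i \<in> {1..m}. x \<notin> F i}"
    using assms by auto
  finally show ?thesis .
qed

lemma indep_odot:
  assumes M: "is_matroid M"
  shows "X \<in> indep (odot M m F) \<longleftrightarrow> X \<subseteq> ground M \<and>
    (\<forall>\<sigma>\<subseteq>{1..m}. X \<inter> odot_cell M m F \<sigma> \<in> indep (contraction M (F_plus F \<sigma>)))"
proof -
  let ?N = "\<lambda>\<sigma>. restriction (contraction M (F_plus F \<sigma>)) (odot_cell M m F \<sigma>)"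
  \<comment> \<open>The contraction deletes only \<open>F_plus F \<sigma>\<close>, which the cell
    avoids.\<close>
  have g: "ground (?N \<sigma>) = odot_cell M m F \<sigma>" for \<sigma>
    by (auto simp: restriction_def contraction_def F_minus_def)
  have disj: "ground (?N s) \<inter> ground (?N t) = {}"
    if "s \<in> Pow {1..m}" "t \<in> Pow {1..m}" "s \<noteq> t" for s t
  proof (rule ccontr)
    assume "\<not> ?thesis"
    then obtain x where x: "x \<in> odot_cell M m F s" "x \<in> odot_cell M m F t" unfolding g by blast
    have "s = {i \<in> {1..m}. x \<notin> F i}"
      using x(1) unfolding odot_cell_iff[OF PowD[OF that(1)]] ..
    also have "\<dots> = t"
      using x(2) unfolding odot_cell_iff[OF PowD[OF that(2)]] by (rule conjunct2[THEN sym])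
    finally show False using that(3) by simp
  qed
  have "(\<Union>\<sigma>\<in>Pow {1..m}. odot_cell M m F \<sigma>) = ground M"
  proof
    show "(\<Union>\<sigma>\<in>Pow {1..m}. odot_cell M m F \<sigma>) \<subseteq> ground M" by (auto simp: F_minus_def)
    show "ground M \<subseteq> (\<Union>\<sigma>\<in>Pow {1..m}. odot_cell M m F \<sigma>)"
    proof
      fix x assume "x \<in> ground M"
      then have "x \<in> odot_cell M m F {i \<in> {1..m}. x \<notin> F i}" by (subst odot_cell_iff) auto
      then show "x \<in> (\<Union>\<sigma>\<in>Pow {1..m}. odot_cell M m F \<sigma>)"
        by (intro UN_I[of "{i \<in> {1..m}. x \<notin> F i}"]) auto
    qed
  qed
  moreover have "X \<in> indep (odot M m F) \<longleftrightarrow>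
      X \<subseteq> (\<Union>s\<in>Pow {1..m}. ground (?N s)) \<and> (\<forall>s\<in>Pow {1..m}. X \<inter> ground (?N s) \<in> indep (?N s))"
    unfolding odot_def
    using is_matroid_restriction[OF is_matroid_contraction[OF M]] disj
    by (rule indep_Direct_Sum)
  ultimately show ?thesis unfolding g indep_restriction by auto
qed

text \<open>The starting set \<open>J\<close> allows two uses: \<open>J = {}\<close> with all
  indices, and \<open>J\<close> a base of the restriction to \<open>F i\<close> with the indices
  containing \<open>i\<close>. In the latter, \<open>J\<close> stands in for the pieces inside
  \<open>F i\<close>.\<close>

lemma indep_odot_Un_cells:
  assumes M: "is_matroid M" and I: "I \<in> indep (odot M m F)" and J: "J \<in> indep M"
    and D: "D \<subseteq> Pow {1..m}" and JD: "\<And>\<sigma>. \<sigma> \<in> D \<Longrightarrow> J \<subseteq> F_plus F \<sigma>"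
  shows "J \<union> (\<Union>\<sigma>\<in>D. I \<inter> odot_cell M m F \<sigma>) \<in> indep M"
proof -
  have "finite D" using D finite_subset by blast
  then show ?thesis using D JD
  proof (induction D rule: finite_ranking_induct[where f = card])
    case empty
    then show ?case using J by simp
  next
    case (insert \<sigma> S)
    let ?K = "J \<union> (\<Union>\<tau>\<in>S. I \<inter> odot_cell M m F \<tau>)"
    have \<sigma>: "\<sigma> \<subseteq> {1..m}" using insert.prems by simp
    have K: "?K \<in> indep M" using insert.IH insert.prems by blast
    show ?case
    \<comment> \<open>The ranking induction gives \<open>card \<tau> \<le> card \<sigma>\<close> for
      \<open>\<tau> \<in> S\<close>, but not that \<open>\<sigma>\<close> is new.\<close>
    proof (cases "\<sigma> \<in> S")
      case True
      then show ?thesis using K by (simp add: insert_absorb)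
    next
      case False
      \<comment> \<open>Since \<open>\<tau>\<close> differs from \<open>\<sigma>\<close> and is no
        larger, some \<open>i \<in> \<sigma>\<close> is missing from it, and the cell of
        \<open>\<tau>\<close> lies in that \<open>F i\<close>.\<close>
      have cells: "odot_cell M m F \<tau> \<subseteq> F_plus F \<sigma>" if t: "\<tau> \<in> S" "\<tau> \<noteq> \<sigma>" for \<tau>
      proof
        fix x assume x: "x \<in> odot_cell M m F \<tau>"
        have \<tau>: "\<tau> \<subseteq> {1..m}" using t insert.prems by auto
        have "\<not> \<sigma> \<subseteq> \<tau>"
        proof
          assume "\<sigma> \<subseteq> \<tau>"
          then have "\<sigma> = \<tau>"
            using card_seteq[of \<tau> \<sigma>] insert.hyps(2)[OF t(1)] \<tau> finite_subset by blast
          then show False using t(2) by simp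
        qed
        then obtain i where i: "i \<in> \<sigma>" "i \<notin> \<tau>" by blast
        have "\<tau> = {i \<in> {1..m}. x \<notin> F i}" using x unfolding odot_cell_iff[OF \<tau>] ..
        then have "x \<in> F i" using i \<sigma> by blast
        then show "x \<in> F_plus F \<sigma>" using i(1) by (auto simp: F_plus_def)
      qed
      have "?K \<subseteq> F_plus F \<sigma>"
        using insert.prems(2)[of \<sigma>] cells False by blast
      moreover have "I \<inter> odot_cell M m F \<sigma> \<in> indep (contraction M (F_plus F \<sigma>))"
        using I \<sigma> indep_odot[OF M] by blast
      ultimately have "(I \<inter> odot_cell M m F \<sigma>) \<union> ?K \<in> indep M"
        using indep_contraction_Un[OF M _ K] by blast
      then show ?thesis by (simp add: Un_ac)
    qed
  qed
qed

text \<open>The two conditions of \<open>indep_face_matroid\<close> come from the two uses of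
  \<open>indep_odot_Un_cells\<close>. In the second,
  \<open>J \<subseteq> F i \<subseteq> F_plus F \<sigma>\<close> whenever
  \<open>i \<in> \<sigma>\<close>.\<close>

lemma indep_odot_subset_face_matroid:
  assumes M: "is_matroid M" and i: "i \<in> {1..m}"
  shows "indep (odot M m F) \<subseteq> indep (face_matroid M (F i))"
proof
  fix I assume I: "I \<in> indep (odot M m F)"
  obtain J where J: "J \<in> bases (restriction M (F i))"
    using bases_nonempty[OF is_matroid_restriction[OF M]] by blast
  have JF: "J \<in> indep M" "J \<subseteq> F i" using bases_indep[OF J] by (auto simp: indep_restriction)
  have Ig: "I \<subseteq> ground M" using I indep_odot[OF M] by blast
  have cell: "x \<in> odot_cell M m F {j \<in> {1..m}. x \<notin> F j}" if "x \<in> I" for x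
    using that Ig by (subst odot_cell_iff) auto
  let ?U = "\<lambda>D. \<Union>\<sigma>\<in>D. I \<inter> odot_cell M m F \<sigma>"
  have "I \<inter> F i \<subseteq> {} \<union> ?U (Pow {1..m})"
  proof
    fix x assume "x \<in> I \<inter> F i"
    then show "x \<in> {} \<union> ?U (Pow {1..m})"
      using cell by (intro UnI2 UN_I[of "{j \<in> {1..m}. x \<notin> F j}"]) auto
  qed
  moreover have "{} \<union> ?U (Pow {1..m}) \<in> indep M"
    by (rule indep_odot_Un_cells[OF M I is_matroidD(4)[OF M] order_refl]) simp
  ultimately have IF: "I \<inter> F i \<in> indep M" by (rule is_matroidD(5)[OF M, rotated])
  have "I - F i \<subseteq> ?U {\<sigma> \<in> Pow {1..m}. i \<in> \<sigma>}"
  proof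
    fix x assume "x \<in> I - F i"
    then show "x \<in> ?U {\<sigma> \<in> Pow {1..m}. i \<in> \<sigma>}"
      using cell i by (intro UN_I[of "{j \<in> {1..m}. x \<notin> F j}"]) auto
  qed
  then have "(I - F i) \<union> J \<subseteq> J \<union> ?U {\<sigma> \<in> Pow {1..m}. i \<in> \<sigma>}" by (simp add: le_supI2)
  moreover have "J \<union> ?U {\<sigma> \<in> Pow {1..m}. i \<in> \<sigma>} \<in> indep M"
    using JF by (intro indep_odot_Un_cells[OF M I]) (auto simp: F_plus_def)
  ultimately have "(I - F i) \<union> J \<in> indep M" by (rule is_matroidD(5)[OF M, rotated])
  then show "I \<in> indep (face_matroid M (F i))" using Ig IF by (simp add: indep_face_matroid[OF M J])
qed

lemma indep_face_matroid_subset: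
  assumes M: "is_matroid M"
  shows "indep (face_matroid M F) \<subseteq> indep M"
  using bases_face_matroid[OF M] by (intro indep_mono_bases is_matroid_face_matroid M) auto

lemma bases_odot_Int_bases_subset:
  assumes M: "is_matroid M" and i: "i \<in> {1..m}"
  shows "bases (odot M m F) \<inter> bases M \<subseteq> bases (face_matroid M (F i))"
proof
  fix B assume B: "B \<in> bases (odot M m F) \<inter> bases M"
  then have "B \<in> indep (face_matroid M (F i))"
    using indep_odot_subset_face_matroid[OF M i] bases_indep by blast
  moreover have "card I \<le> card B" if "I \<in> indep (face_matroid M (F i))" for I
    using B that indep_face_matroid_subset[OF M] by (intro bases_card_ge[OF M]) auto
  ultimately show "B \<in> bases (face_matroid M (F i))"
    by (simp add: bases_iff_card[OF is_matroid_face_matroid[OF M]])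
qed

text \<open>By \<open>base_restriction_UN\<close>, \<open>B\<close> itself provides the test set
  \<open>B \<inter> F_plus F \<sigma>\<close> for each contraction, and adding the part of
  \<open>B\<close> in the cell stays inside \<open>B\<close>. Maximality is inherited from
  \<open>M\<close>, whose independent sets include those of \<open>odot\<close>.\<close>

lemma base_inter_subset_bases_odot:
  assumes M: "is_matroid M" and m: "m \<ge> 1"
    and B: "\<And>i. i \<in> {1..m} \<Longrightarrow> B \<in> bases (face_matroid M (F i))"
  shows "B \<in> bases (odot M m F)"
proof -
  have BM: "B \<in> bases M" using B[of 1] m by (auto simp: bases_face_matroid[OF M])
  have "B \<inter> odot_cell M m F \<sigma> \<in> indep (contraction M (F_plus F \<sigma>))" if \<sigma>: "\<sigma> \<subseteq> {1..m}" for \<sigma>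
  proof -
    have "B \<inter> F_plus F \<sigma> \<in> bases (restriction M (F_plus F \<sigma>))"
      unfolding F_plus_def using B \<sigma>
      by (intro base_restriction_UN M bases_indep[OF BM]) (auto simp: bases_face_matroid[OF M])
    moreover have "(B \<inter> odot_cell M m F \<sigma>) \<union> (B \<inter> F_plus F \<sigma>) \<in> indep M"
      by (rule is_matroidD(5)[OF M bases_indep[OF BM]]) blast
    ultimately show ?thesis
      by (subst indep_contraction[OF M]) (auto simp: F_minus_def)
  qed
  then have "B \<in> indep (odot M m F)"
    using is_matroidD(2)[OF M bases_indep[OF BM]] by (simp add: indep_odot[OF M])
  moreover have "indep (odot M m F) \<subseteq> indep M"
    using indep_odot_subset_face_matroid[OF M, of 1 m F] m
      indep_face_matroid_subset[OF M, of "F 1"] by auto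
  ultimately show ?thesis using BM by (auto simp: bases_def)
qed

section \<open>Equivalence of the six conditions\<close>

theorem theorem2p25:
  fixes M :: "'a matroid" and F :: "nat \<Rightarrow> 'a set" and m :: nat
  assumes "is_matroid M"
    and "m \<ge> 1"
    and "\<And>i. i \<in> {1..m} \<Longrightarrow> F i \<subseteq> ground M"
  shows
    "let baseInter = (\<Inter>i\<in>{1..m}. bases (face_matroid M (F i)));
         iter = (\<lambda>\<tau>. iter_face_matroid M (map (\<lambda>i. F (\<tau> i)) [1..<Suc m]));
         c1 = (baseInter \<noteq> {});
         c2 = (\<forall>\<tau> \<tau>'. \<tau> permutes {1..m} \<longrightarrow> \<tau>' permutes {1..m} \<longrightarrow> iter \<tau> = iter \<tau>');
         c3 = (\<exists>\<tau>. \<tau> permutes {1..m} \<and> baseInter = bases (iter \<tau>));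
         c4 = (baseInter = bases (odot M m F));
         c5 = (\<exists>\<tau>. \<tau> permutes {1..m} \<and> odot M m F = iter \<tau>);
         c6 = (rank (odot M m F) = rank M)
     in (c1 \<longleftrightarrow> c2) \<and> (c1 \<longleftrightarrow> c3) \<and> (c1 \<longleftrightarrow> c4) \<and> (c1 \<longleftrightarrow> c5) \<and> (c1 \<longleftrightarrow> c6)"
proof -
  note M = assms(1) and m = assms(2)
  define S where "S = (\<Inter>i\<in>{1..m}. bases (face_matroid M (F i)))"
  define iter where "iter = (\<lambda>\<tau>. iter_face_matroid M (map (\<lambda>i. F (\<tau> i)) [1..<Suc m]))"
  have O: "is_matroid (odot M m F)" by (rule is_matroid_odot[OF M])
  have It: "is_matroid (iter \<tau>)" for \<tau>
    unfolding iter_def by (rule is_matroid_iter_face_matroid[OF M])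
  have S_iff: "B \<in> S \<longleftrightarrow> B \<in> bases M \<and> (\<forall>i\<in>{1..m}. B \<inter> F i \<in> bases (restriction M (F i)))" for B
    using m by (auto simp: S_def bases_face_matroid[OF M])
  have S_odot: "S \<subseteq> bases (odot M m F)"
    using base_inter_subset_bases_odot[OF M m] by (auto simp: S_def)
  have odot_S: "bases (odot M m F) \<inter> bases M \<subseteq> S"
    using bases_odot_Int_bases_subset[OF M] by (fastforce simp: S_def)
  \<comment> \<open>Bases of \<open>odot\<close> are independent in \<open>M\<close>; equal rank
    gives them the size of a base of \<open>M\<close>.\<close>
  have odot_M: "bases (odot M m F) \<subseteq> bases M" if r: "rank (odot M m F) = rank M"
  proof
    fix B assume B: "B \<in> bases (odot M m F)"
    have "B \<in> indep M"
      using indep_odot_subset_face_matroid[OF M, of 1 m F] m bases_indep[OF B]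
        indep_face_matroid_subset[OF M, of "F 1"] by auto
    moreover obtain C where C: "C \<in> bases M" using bases_nonempty[OF M] by blast
    then have "card B = card C"
      using r rank_eq_card_base[OF M C] rank_eq_card_base[OF O B] by simp
    ultimately show "B \<in> bases M" using C by (simp add: bases_iff_card[OF M])
  qed
  \<comment> \<open>Each fact \<open>cij\<close> below derives condition (j) from condition (i),
    with (1) read as \<open>S \<noteq> {}\<close>.\<close>
  have c16: "rank (odot M m F) = rank M" if S: "S \<noteq> {}"
  proof -
    obtain B where B: "B \<in> S" using S by blast
    then have "B \<in> bases M" "B \<in> bases (odot M m F)" using S_iff S_odot by auto
    then show ?thesis using rank_eq_card_base[OF M] rank_eq_card_base[OF O] by simp
  qed
  have c64: "S = bases (odot M m F)" if "rank (odot M m F) = rank M"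
    using odot_M[OF that] odot_S S_odot by blast
  have c41: "S \<noteq> {}" if "S = bases (odot M m F)" using that bases_nonempty[OF O] by simp
  \<comment> \<open>Any member of \<open>S\<close> is a witness for every order of the
    \<open>F i\<close> at once, so the bases of the iterate do not depend on
    \<open>\<tau>\<close>.\<close>
  have iter_S: "bases (iter \<tau>) = S" if S: "S \<noteq> {}" and \<tau>: "\<tau> permutes {1..m}" for \<tau>
  proof -
    obtain C where C: "C \<in> S" using S by blast
    have s: "set (map (\<lambda>i. F (\<tau> i)) [1..<Suc m]) = F ` {1..m}"
      using permutes_image[OF \<tau>]
      by (metis image_image set_map set_upt atLeastLessThanSuc_atLeastAtMost)
    have "bases (iter \<tau>) = {B \<in> bases M. \<forall>G\<in>F ` {1..m}. B \<inter> G \<in> bases (restriction M G)}"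
      unfolding iter_def s[symmetric]
      by (rule bases_iter_face_matroid[OF M, of C]) (use C s S_iff in auto)
    then show ?thesis using S_iff by auto
  qed
  have c13: "\<exists>\<tau>. \<tau> permutes {1..m} \<and> S = bases (iter \<tau>)" if "S \<noteq> {}"
    using iter_S[OF that] permutes_id by metis
  have c31: "S \<noteq> {}" if "\<exists>\<tau>. \<tau> permutes {1..m} \<and> S = bases (iter \<tau>)"
    using that bases_nonempty[OF It] by auto
  have c12: "iter \<tau> = iter \<tau>'" if "S \<noteq> {}" "\<tau> permutes {1..m}" "\<tau>' permutes {1..m}" for \<tau> \<tau>'
    using iter_S that
    by (intro matroid_eqI It) (auto simp: iter_def ground_iter_face_matroid)
  \<comment> \<open>Transposing 1 and \<open>i\<close> puts \<open>F i\<close> first, and bases of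
    an iterate are bases of its first stage. If all iterates agree, a single base is therefore a
    base of every M(F_i).\<close>
  have c21: "S \<noteq> {}"
    if eq: "\<forall>\<tau> \<tau>'. \<tau> permutes {1..m} \<longrightarrow> \<tau>' permutes {1..m} \<longrightarrow> iter \<tau> = iter \<tau>'"
  proof -
    obtain B where B: "B \<in> bases (iter id)" using bases_nonempty[OF It] by blast
    have "B \<in> bases (face_matroid M (F i))" if i: "i \<in> {1..m}" for i
    proof -
      let ?t = "transpose 1 i"
      have "?t permutes {1..m}" using i m by (intro permutes_swap_id) auto
      then have "B \<in> bases (iter ?t)" using B eq permutes_id by metis
      moreover have "iter ?t =
          iter_face_matroid (face_matroid M (F i)) (map (\<lambda>j. F (?t j)) [Suc 1..<Suc m])"
        unfolding iter_def using m by (subst upt_conv_Cons) (simp_all add: iter_face_matroid_def)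
      ultimately show ?thesis
        using bases_iter_face_matroid_subset[OF is_matroid_face_matroid[OF M]] by auto
    qed
    then have "B \<in> S" by (simp add: S_def)
    then show ?thesis by blast
  qed
  have c15: "\<exists>\<tau>. \<tau> permutes {1..m} \<and> odot M m F = iter \<tau>" if S: "S \<noteq> {}"
  proof -
    have "odot M m F = iter id"
      using iter_S[OF S permutes_id] c64[OF c16[OF S]] ground_odot[OF assms(3)]
      by (intro matroid_eqI O It) (auto simp: iter_def ground_iter_face_matroid)
    then show ?thesis using permutes_id by metis
  qed
  \<comment> \<open>Bases of an iterate are bases of \<open>M\<close>, so (5) makes every base of
    \<open>odot\<close> a base of \<open>M\<close>, and \<open>odot_S\<close> applies.\<close>
  have c51: "S \<noteq> {}" if "\<exists>\<tau>. \<tau> permutes {1..m} \<and> odot M m F = iter \<tau>"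
  proof -
    have "bases (odot M m F) \<subseteq> bases M"
      using that bases_iter_face_matroid_subset[OF M] unfolding iter_def by metis
    then show ?thesis using odot_S bases_nonempty[OF O] by blast
  qed
  show ?thesis
    unfolding Let_def S_def[symmetric] iter_def[symmetric]
    using c12 c21 c13 c31 c15 c51 c16 c64 c41 by (intro conjI iffI) blast+
qed

end
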